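(* Let $d\ge2$, and let $X$ and $Z$ be the $d$-dimensional shift and clock operators. Define $$J_d(A,B)\equiv\left[A^dB\right]^{d-1}A\left[B^dA\right]^{d-1}B .$$ If $X'$ and $Z'$ are $d\times d$ unitaries with $\det X'=\det X$, $\det Z'=\det Z$, $\|X'-X\|\le\epsilon$ and $\|Z'-Z\|\le\epsilon$, then $$J_d(X',Z')=I+O(\epsilon^2)\qquad\text{and}\qquad J_d(Z',X')=I+O(\epsilon^2).$$
   Context: With $\omega=e^{2\pi i/d}$, the clock and shift operators are $Z=\sum_{j=0}^{d-1}\omega^j|j\rangle\langle j|$ and $X=\sum_{j=0}^{d-1}|j+1\bmod d\rangle\langle j|$. $\|\cdot\|$ is the operator norm. The notation $M=I+O(\epsilon^2)$ means: there exist $\epsilon_*>0$ and $C>0$, depending only on $d$, such that $\|M-I\|\le C\epsilon^2$ for all $\epsilon\in[0,\epsilon_* )$ and all admissible $X',Z'$. *)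

theory Defs
  imports
    Complex_Main
    "HOL-Analysis.L2_Norm"
    "Jordan_Normal_Form.Matrix"
    "Jordan_Normal_Form.Determinant"
    "Jordan_Normal_Form.Schur_Decomposition"
begin

definition omega :: "nat \<Rightarrow> complex" where
  "omega d = exp (2 * complex_of_real pi * \<i> / of_nat d)"

definition clock_mat :: "nat \<Rightarrow> complex mat" where
  "clock_mat d = mat d d (\<lambda>(i, j). if i = j then omega d ^ j else 0)"

(* The summand |j+1 mod d><j| has its only nonzero entry in row (j+1) mod d and column j. *)
definition shift_mat :: "nat \<Rightarrow> complex mat" where
  "shift_mat d = mat d d (\<lambda>(i, j). if i = (j + 1) mod d then 1 else 0)"

definition unitary_mat :: "complex mat \<Rightarrow> bool" where
  "unitary_mat U \<longleftrightarrow> square_mat U \<and>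
     mat_adjoint U * U = 1\<^sub>m (dim_row U) \<and> U * mat_adjoint U = 1\<^sub>m (dim_row U)"

definition l2_norm_vec :: "complex vec \<Rightarrow> real" where
  "l2_norm_vec v = L2_set (\<lambda>i. cmod (v $ i)) {..<dim_vec v}"

(* Supremum over the closed unit ball. The set is nonempty (it contains 0) and bounded above,
   so the conditionally complete supremum on the reals is the genuine one. *)
definition op_norm_mat :: "complex mat \<Rightarrow> real" where
  "op_norm_mat A =
     (SUP v \<in> {v \<in> carrier_vec (dim_col A). l2_norm_vec v \<le> 1}. l2_norm_vec (A *\<^sub>v v))"

definition J_word :: "nat \<Rightarrow> complex mat \<Rightarrow> complex mat \<Rightarrow> complex mat" where
  "J_word d A B =
     (A ^\<^sub>m d * B) ^\<^sub>m (d - 1) * A * (B ^\<^sub>m d * A) ^\<^sub>m (d - 1) * B"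

end

theory Submission
  imports Defs "HOL-Library.Landau_Symbols"
begin

text \<open>
  Write \<open>X' = X + E\<close> and \<open>Z' = Z + F\<close> and expand everything to first order. Let \<open>P\<close> and \<open>Q\<close>
  be the first-order parts of \<open>X'^d\<close> and \<open>Z'^d\<close>. Since \<open>Q\<close> commutes with \<open>Z\<close>, the first-order part
  of \<open>J_d(X', Z')\<close> telescopes to \<open>S + Z^(d-1) T Z\<close>, where \<open>S\<close> is the sum of \<open>Z^i P Z^(-i)\<close> and
  \<open>T\<close> the sum of \<open>X^i Q X^(-i)\<close> over one period. These averages over the clock and shift conjugations
  are the scalars \<open>d tr(X^(-1) E)\<close> and \<open>d tr(Z^(-1) F)\<close>. The determinant conditions say
  \<open>det(1 + X^(-1) E) = det(1 + Z^(-1) F) = 1\<close>, and \<open>det(1 + H) = 1 + tr H\<close> up to second order,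
  so both scalars are of second order.
\<close>

section \<open>Operator norm and matrix entries\<close>

lemma norm_entry_le_one:
  assumes "l2_norm_vec v \<le> 1" "j < dim_vec v"
  shows "cmod (v $ j) \<le> 1"
proof -
  have "cmod (v $ j) \<le> l2_norm_vec v"
    unfolding l2_norm_vec_def using assms(2) by (intro member_le_L2_set) auto
  with assms(1) show ?thesis by simp
qed

text \<open>Needed twice: it bounds the operator norm from above, and it shows that the set whose
  supremum defines this norm is bounded.\<close>

lemma l2_norm_mult_mat_vec_le:
  assumes "v \<in> carrier_vec (dim_col A)" "l2_norm_vec v \<le> 1"
  shows "l2_norm_vec (A *\<^sub>v v) \<le> (\<Sum>i<dim_row A. \<Sum>j<dim_col A. cmod (A $$ (i,j)))"
proof -
  have "l2_norm_vec (A *\<^sub>v v) \<le> (\<Sum>i<dim_row A. cmod ((A *\<^sub>v v) $ i))"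
    unfolding l2_norm_vec_def dim_mult_mat_vec by (rule L2_set_le_sum) simp
  also have "\<dots> \<le> (\<Sum>i<dim_row A. \<Sum>j<dim_col A. cmod (A $$ (i,j)))"
  proof (intro sum_mono)
    fix i assume i: "i \<in> {..<dim_row A}"
    have "(A *\<^sub>v v) $ i = (\<Sum>j<dim_col A. A $$ (i,j) * v $ j)"
      using i assms by (simp add: scalar_prod_def row_def atLeast0LessThan)
    also have "cmod \<dots> \<le> (\<Sum>j<dim_col A. cmod (A $$ (i,j) * v $ j))" by (rule norm_sum)
    also have "\<dots> \<le> (\<Sum>j<dim_col A. cmod (A $$ (i,j)) * 1)"
      unfolding norm_mult using assms
      by (intro sum_mono mult_left_mono norm_entry_le_one) auto
    finally show "cmod ((A *\<^sub>v v) $ i) \<le> (\<Sum>j<dim_col A. cmod (A $$ (i,j)))" by simp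
  qed
  finally show ?thesis .
qed

lemma l2_norm_zero_vec: "l2_norm_vec (0\<^sub>v n) = 0"
  by (simp add: l2_norm_vec_def L2_set_def)

lemma op_norm_mat_le_sum_entries:
  "op_norm_mat A \<le> (\<Sum>i<dim_row A. \<Sum>j<dim_col A. cmod (A $$ (i,j)))"
  unfolding op_norm_mat_def
proof (rule cSUP_least)
  have "0\<^sub>v (dim_col A) \<in> {v \<in> carrier_vec (dim_col A). l2_norm_vec v \<le> 1}"
    by (simp add: l2_norm_zero_vec)
  thus "{v \<in> carrier_vec (dim_col A). l2_norm_vec v \<le> 1} \<noteq> {}" by blast
qed (auto intro: l2_norm_mult_mat_vec_le)

text \<open>The \<open>j\<close>-th unit vector lies in the unit ball and is sent to column
  \<open>j\<close>, whose norm dominates each of its coordinates. With the preceding bound, operator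
  norm and entry size of \<open>d\<close> by \<open>d\<close> matrices are equivalent up to a factor
  depending only on \<open>d\<close>.\<close>

lemma entry_le_op_norm_mat:
  assumes "i < dim_row A" "j < dim_col A"
  shows "cmod (A $$ (i,j)) \<le> op_norm_mat A"
proof -
  let ?S = "{v \<in> carrier_vec (dim_col A). l2_norm_vec v \<le> 1}"
  let ?u = "unit_vec (dim_col A) j"
  have "(\<Sum>i<dim_col A. (cmod (?u $ i))\<^sup>2) = (\<Sum>i<dim_col A. if i = j then 1 else 0)"
    by (intro sum.cong) (use assms in auto)
  hence "l2_norm_vec ?u = 1"
    unfolding l2_norm_vec_def L2_set_def using assms by simp
  hence u: "?u \<in> ?S" by simp
  have col: "A *\<^sub>v ?u = col A j"
    using assms by (intro eq_vecI) (auto simp: scalar_prod_right_unit)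
  have "cmod (A $$ (i,j)) = cmod ((A *\<^sub>v ?u) $ i)" using assms col by simp
  also have "\<dots> \<le> l2_norm_vec (A *\<^sub>v ?u)"
    unfolding l2_norm_vec_def using assms by (intro member_le_L2_set) auto
  also have "\<dots> \<le> op_norm_mat A"
    unfolding op_norm_mat_def
    by (intro cSUP_upper u bdd_aboveI2) (rule l2_norm_mult_mat_vec_le; auto)
  finally show ?thesis .
qed

section \<open>Derivatives of matrix powers and of the word\<close>

(* The derivative of M ^ k in direction N, i.e. the sum of M ^ i * N * M ^ (k - 1 - i) over i < k. *)
fun dpow :: "'a :: semiring_1 mat \<Rightarrow> 'a mat \<Rightarrow> nat \<Rightarrow> 'a mat" where
  "dpow M N 0 = 0\<^sub>m (dim_row M) (dim_row M)"
| "dpow M N (Suc k) = M ^\<^sub>m k * N + dpow M N k * M"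

lemma pow_mat_Suc_left:
  fixes M :: "'a :: comm_ring_1 mat"
  assumes M: "M \<in> carrier_mat d d"
  shows "M ^\<^sub>m Suc k = M * M ^\<^sub>m k"
proof (induction k)
  case (Suc k)
  have "M ^\<^sub>m Suc (Suc k) = (M * M ^\<^sub>m k) * M" using Suc by simp
  also have "\<dots> = M * M ^\<^sub>m Suc k" using M by (simp add: assoc_mult_mat[of _ d d _ d _ d] pow_carrier_mat)
  finally show ?case .
qed (use M in auto)

context
  fixes d :: nat and M N :: "'a :: comm_ring_1 mat"
  assumes M: "M \<in> carrier_mat d d" and N: "N \<in> carrier_mat d d"
begin

lemma dpow_carrier: "dpow M N k \<in> carrier_mat d d"
  using M N by (induction k) auto

text \<open>The defining recursion splits off the last factor of the power, this one the first.
  Comparing the two gives \<open>dpow_commute\<close>.\<close>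

lemma dpow_Suc_left: "dpow M N (Suc k) = M * dpow M N k + N * M ^\<^sub>m k"
proof (induction k)
  case (Suc k)
  have c: "dpow M N k \<in> carrier_mat d d" "M ^\<^sub>m k \<in> carrier_mat d d"
    using M by (auto intro: dpow_carrier pow_carrier_mat)
  have c2: "M ^\<^sub>m k * N \<in> carrier_mat d d" "dpow M N k * M \<in> carrier_mat d d"
    using c M N by auto
  have c3: "M * (M ^\<^sub>m k * N) \<in> carrier_mat d d" "M * (dpow M N k * M) \<in> carrier_mat d d"
    "N * (M ^\<^sub>m k * M) \<in> carrier_mat d d"
    by (rule mult_carrier_mat[of _ d d], use c c2 M N in simp_all)+
  have "dpow M N (Suc (Suc k)) = M ^\<^sub>m Suc k * N + (M * dpow M N k + N * M ^\<^sub>m k) * M"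
    using Suc by simp
  also have "\<dots> = M * M ^\<^sub>m k * N + (M * (dpow M N k * M) + N * M ^\<^sub>m Suc k)"
    using M N c unfolding pow_mat_Suc_left[OF M]
    by (simp add: add_mult_distrib_mat[of _ d d _ _ d] assoc_mult_mat[of _ d d _ d _ d]
        pow_mat_Suc_left[OF M, symmetric])
  also have "\<dots> = M * dpow M N (Suc k) + N * M ^\<^sub>m Suc k"
    using M N c c2 assoc_add_mat[OF c3]
    by (simp add: mult_add_distrib_mat[of _ d d _ d] assoc_mult_mat[of _ d d _ d _ d])
  finally show ?case .
qed (use M N in auto)

end

lemma dpow_add:
  fixes M :: "'a :: comm_ring_1 mat"
  assumes M: "M \<in> carrier_mat d d" and N: "N \<in> carrier_mat d d" and N': "N' \<in> carrier_mat d d"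
  shows "dpow M (N + N') k = dpow M N k + dpow M N' k"
proof (induction k)
  case (Suc k)
  have c: "dpow M N k \<in> carrier_mat d d" "dpow M N' k \<in> carrier_mat d d" "M ^\<^sub>m k \<in> carrier_mat d d"
    using M N N' by (auto intro: dpow_carrier pow_carrier_mat)
  have c2: "M ^\<^sub>m k * N \<in> carrier_mat d d" "M ^\<^sub>m k * N' \<in> carrier_mat d d"
     "dpow M N k * M \<in> carrier_mat d d" "dpow M N' k * M \<in> carrier_mat d d"
    using c M N N' by auto
  show ?case using M N N' c c2 Suc
    by (auto simp: add_mult_distrib_mat[of _ d d _ _ d] mult_add_distrib_mat[of _ d d _ d]
      intro!: eq_matI)
qed (use M N in auto)

text \<open>In general the two products differ by the commutator of \<open>M^k\<close> with
  \<open>N\<close>, as the two recursions for exponent \<open>k + 1\<close> show. Once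
  \<open>M^k\<close> is the identity, \<open>N\<close> cancels.\<close>

lemma dpow_commute:
  fixes M :: "'a :: comm_ring_1 mat"
  assumes M: "M \<in> carrier_mat d d" and N: "N \<in> carrier_mat d d" and one: "M ^\<^sub>m k = 1\<^sub>m d"
  shows "M * dpow M N k = dpow M N k * M"
proof -
  have c: "M * dpow M N k \<in> carrier_mat d d" "dpow M N k * M \<in> carrier_mat d d"
    using dpow_carrier[OF M N, of k] M by auto
  have cancel: "A = B" if "N + B = A + N" "A \<in> carrier_mat d d" "B \<in> carrier_mat d d" for A B
  proof -
    show ?thesis
    proof (rule eq_matI)
      fix i j assume "i < dim_row B" "j < dim_col B"
      moreover have "(N + B) $$ (i,j) = (A + N) $$ (i,j)" using that(1) by simp
      ultimately show "A $$ (i,j) = B $$ (i,j)" using that(2,3) N by auto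
    qed (use that in auto)
  qed
  have "N + dpow M N k * M = M * dpow M N k + N"
    using dpow_Suc_left[OF M N, of k] N one by simp
  from this c show ?thesis by (rule cancel)
qed

(* The left-hand side is the first-order term of J_word at (U, V) in the direction (E, F),
   in the shape in which the product rule produces it. *)
lemma J_word_derivative:
  fixes U V :: "'a :: comm_ring_1 mat"
  assumes d: "d > 0"
    and U: "U \<in> carrier_mat d d" and V: "V \<in> carrier_mat d d"
    and E: "E \<in> carrier_mat d d" and F: "F \<in> carrier_mat d d"
    and Ud: "U ^\<^sub>m d = 1\<^sub>m d" and Vd: "V ^\<^sub>m d = 1\<^sub>m d"
  defines "P \<equiv> dpow U E d" and "Q \<equiv> dpow V F d"
  defines "R \<equiv> dpow V (F + P * V) (d - 1)" and "S \<equiv> dpow U (E + Q * U) (d - 1)"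
  shows "V ^\<^sub>m (d-1) * F + (V ^\<^sub>m (d-1) * U * S + (V ^\<^sub>m (d-1) * E + R * U) * U ^\<^sub>m (d-1)) * V
    = dpow V (P * V) d + V ^\<^sub>m (d-1) * dpow U (Q * U) d * V"
proof -
  obtain k where k: "d = Suc k" using d by (cases d) auto
  \<comment> \<open>Since \<open>d = Suc k\<close>, these are the inverses of \<open>V\<close> and
    \<open>U\<close>.\<close>
  define v where "v = V ^\<^sub>m k" define u where "u = U ^\<^sub>m k"
  have uv: "u \<in> carrier_mat d d" "v \<in> carrier_mat d d" using U V by (auto simp: u_def v_def pow_carrier_mat)
  have Uu: "U * u = 1\<^sub>m d" using pow_mat_Suc_left[OF U, of k] Ud k by (simp add: u_def)
  have vV: "v * V = 1\<^sub>m d" using Vd k by (simp add: v_def)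
  have PQ: "P \<in> carrier_mat d d" "Q \<in> carrier_mat d d"
    using U V E F by (auto simp: P_def Q_def intro: dpow_carrier)
  have PV: "P * V \<in> carrier_mat d d" and QU: "Q * U \<in> carrier_mat d d" using PQ U V by auto
  \<comment> \<open>The directions in \<open>R\<close> and \<open>S\<close> have two summands: the
    direct perturbation (\<open>R1\<close>, \<open>S1\<close>), and the one entering through the
    \<open>d\<close>-th power of the other matrix (\<open>R2\<close>, \<open>S2\<close>).\<close>
  define R1 where "R1 = dpow V F k" define R2 where "R2 = dpow V (P * V) k"
  define S1 where "S1 = dpow U E k" define S2 where "S2 = dpow U (Q * U) k"
  have RS: "R1 \<in> carrier_mat d d" "R2 \<in> carrier_mat d d" "S1 \<in> carrier_mat d d" "S2 \<in> carrier_mat d d"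
    using U V E F PV QU by (auto simp: R1_def R2_def S1_def S2_def intro: dpow_carrier)
  have R: "R = R1 + R2" unfolding R_def R1_def R2_def k diff_Suc_1
    using dpow_add[OF V F PV, of k] by (simp add: k)
  have S: "S = S1 + S2" unfolding S_def S1_def S2_def k diff_Suc_1
    using dpow_add[OF U E QU, of k] by (simp add: k)
  have D1: "dpow V (P * V) d = v * (P * V) + R2 * V" by (simp add: k v_def R2_def)
  have Q: "Q = v * F + R1 * V" by (simp add: Q_def k v_def R1_def)
  have D2: "dpow U (Q * U) d = U * S2 + Q"
  proof -
    have "Q * U * u = Q" using PQ U uv Uu by (simp add: assoc_mult_mat[of _ d d _ d _ d])
    thus ?thesis using dpow_Suc_left[OF U QU, of k] by (simp add: k S2_def u_def)
  qed
  \<comment> \<open>\<open>P\<close> is expanded from the left and \<open>Q\<close> from the right,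
    because \<open>U * S1 + E * u\<close> and \<open>v * F + R1 * V\<close> are the shapes in which
    they reappear in the word.\<close>
  have P: "P = U * S1 + E * u" using dpow_Suc_left[OF U E, of k] by (simp add: P_def k S1_def u_def)
  have VQ: "V * Q = Q * V" unfolding Q_def by (rule dpow_commute[OF V F Vd])
  have vQV: "v * Q * V = Q"
  proof -
    have "v * Q * V = v * V * Q" using VQ uv PQ V by (simp add: assoc_mult_mat[of _ d d _ d _ d])
    thus ?thesis using vV PQ by simp
  qed
  note assoc = assoc_mult_mat[of _ d d _ d _ d]
    and distr = add_mult_distrib_mat[of _ d d _ _ d] mult_add_distrib_mat[of _ d d _ d]
  \<comment> \<open>Addition is associative and commutative only for matching dimensions, so these
    two rearrangements are verified entry by entry.\<close>
  have shuffle1: "a + r + (b + c) = r + (b + a + c)"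
    if "a \<in> carrier_mat n n" "b \<in> carrier_mat n n" "c \<in> carrier_mat n n" "r \<in> carrier_mat n n"
    for a b c r :: "'a mat" and n using that by (intro eq_matI) auto
  have shuffle2: "a + (b + (c + (p + g))) = p + c + (g + (a + b))"
    if "a \<in> carrier_mat n n" "b \<in> carrier_mat n n" "c \<in> carrier_mat n n"
      "p \<in> carrier_mat n n" "g \<in> carrier_mat n n"
    for a b c p g :: "'a mat" and n using that by (intro eq_matI) auto
  define G where "G = U * S2"
  have G: "G \<in> carrier_mat d d" using U RS by (simp add: G_def)
  have c: "v * F \<in> carrier_mat d d" "R1 * V \<in> carrier_mat d d" "R2 * V \<in> carrier_mat d d"
    "v * P * V \<in> carrier_mat d d" "v * G * V \<in> carrier_mat d d"
    using uv RS PQ U V F G by auto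
  have "v * U * S + (v * E + R * U) * u = (v * E + R * U) * u + v * U * S"
    using U V uv RS E R S by (intro comm_add_mat[of _ d d]) auto
  also have "\<dots> = v * (E * u) + R * (U * u) + v * (U * S)"
    using U V uv RS E R S by (simp add: distr assoc)
  also have "\<dots> = R + v * (P + G)"
  proof -
    have "v * (E * u) + R + (v * (U * S1) + v * G) = R + (v * (U * S1) + v * (E * u) + v * G)"
      using U uv RS E G R by (intro shuffle1[of _ d]) auto
    moreover have "v * (U * S) = v * (U * S1) + v * G"
      unfolding S G_def using U uv RS by (simp add: distr)
    moreover have "v * (P + G) = v * (U * S1) + v * (E * u) + v * G"
      unfolding P using U uv RS E G by (simp add: distr)
    moreover have "R * (U * u) = R" unfolding Uu using R RS by simp
    ultimately show ?thesis by simp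
  qed
  finally have eq: "v * U * S + (v * E + R * U) * u = R + v * (P + G)" .
  have "v * F + (v * U * S + (v * E + R * U) * u) * V
      = v * F + (R1 * V + (R2 * V + (v * P * V + v * G * V)))"
    unfolding eq unfolding R using V uv RS PQ G by (simp add: distr)
  also have "\<dots> = v * P * V + R2 * V + (v * G * V + (v * F + R1 * V))"
    by (rule shuffle2[OF c])
  \<comment> \<open>The bracket \<open>v * F + R1 * V\<close> is \<open>Q\<close>. Being invariant
    under conjugation by \<open>V\<close>, it can join \<open>G\<close> between \<open>v\<close> and
    \<open>V\<close>, which completes the derivative in \<open>D2\<close>.\<close>
  also have "\<dots> = v * P * V + R2 * V + (v * G * V + v * Q * V)" by (simp only: vQV Q[symmetric])
  also have "\<dots> = v * (P * V) + R2 * V + v * (G + Q) * V"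
    using V uv RS PQ G by (simp add: distr assoc)
  finally show ?thesis unfolding D1 D2 G_def by (simp add: u_def v_def k)
qed

section \<open>Matrix families of order e^k and first-order expansions\<close>

lemma index_mult_mat_sum:
  assumes "A \<in> carrier_mat n m" "B \<in> carrier_mat m l" "i < n" "j < l"
  shows "(A * B) $$ (i,j) = (\<Sum>k<m. A $$ (i,k) * B $$ (k,j))"
  using assms by (simp add: scalar_prod_def atLeast0LessThan)

text \<open>An index \<open>s\<close> stands for one choice of perturbed data. With
  \<open>F = top\<close> a Landau bound holds for all \<open>s\<close> with a single constant, which
  gives the required uniformity. A complex \<open>e\<close> can be compared directly with matrix
  entries, and its boundedness makes higher order imply lower order.\<close>

locale first_order =
  fixes d :: nat and F :: "'s filter" and e :: "'s \<Rightarrow> complex"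
  assumes e_bounded: "e \<in> O[F](\<lambda>_. 1)"
begin

definition mat_bigo :: "nat \<Rightarrow> ('s \<Rightarrow> complex mat) \<Rightarrow> bool" where
  "mat_bigo k M \<longleftrightarrow> (\<forall>s. M s \<in> carrier_mat d d) \<and>
     (\<forall>i<d. \<forall>j<d. (\<lambda>s. M s $$ (i,j)) \<in> O[F](\<lambda>s. e s ^ k))"

lemma mat_bigo_carrier: "mat_bigo k M \<Longrightarrow> M s \<in> carrier_mat d d"
  by (simp add: mat_bigo_def)

lemma mat_bigo_entry:
  "mat_bigo k M \<Longrightarrow> i < d \<Longrightarrow> j < d \<Longrightarrow> (\<lambda>s. M s $$ (i,j)) \<in> O[F](\<lambda>s. e s ^ k)"
  by (simp add: mat_bigo_def)

lemma bigo_e_Suc: "f \<in> O[F](\<lambda>s. e s ^ Suc k) \<Longrightarrow> f \<in> O[F](\<lambda>s. e s ^ k)"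
  by (erule landau_o.big.trans) (use landau_o.big.mult[OF e_bounded, of "\<lambda>s. e s ^ k"] in simp)

lemma bigo_e_1:
  assumes "f \<in> O[F](e)"
  shows "f \<in> O[F](\<lambda>_. 1)"
  using bigo_e_Suc[of f 0] assms by simp

lemma mat_bigo_const: "M \<in> carrier_mat d d \<Longrightarrow> mat_bigo 0 (\<lambda>_. M)"
  by (simp add: mat_bigo_def)

lemma mat_bigo_Suc: "mat_bigo (Suc k) M \<Longrightarrow> mat_bigo k M"
  unfolding mat_bigo_def using bigo_e_Suc by blast

lemma mat_bigo_add:
  assumes "mat_bigo k M" "mat_bigo k N"
  shows "mat_bigo k (\<lambda>s. M s + N s)"
proof -
  have "dim_row (N s) = d" "dim_col (N s) = d" for s using mat_bigo_carrier[OF assms(2), of s] by auto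
  thus ?thesis using assms unfolding mat_bigo_def by (auto intro: sum_in_bigo)
qed

lemma mat_bigo_mult:
  assumes M: "mat_bigo k M" and N: "mat_bigo l N"
  shows "mat_bigo (k + l) (\<lambda>s. M s * N s)"
  unfolding mat_bigo_def
proof (intro conjI allI impI)
  fix i j assume ij: "i < d" "j < d"
  have "(\<lambda>s. (M s * N s) $$ (i,j)) = (\<lambda>s. \<Sum>c<d. M s $$ (i,c) * N s $$ (c,j))"
    using ij by (intro ext index_mult_mat_sum[where n = d and l = d] mat_bigo_carrier[OF M] mat_bigo_carrier[OF N])
  also have "\<dots> \<in> O[F](\<lambda>s. e s ^ (k + l))"
    unfolding power_add
    by (intro big_sum_in_bigo landau_o.big.mult mat_bigo_entry[OF M] mat_bigo_entry[OF N]) (use ij in auto)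
  finally show "(\<lambda>s. (M s * N s) $$ (i,j)) \<in> O[F](\<lambda>s. e s ^ (k + l))" .
next
  fix s show "M s * N s \<in> carrier_mat d d" using mat_bigo_carrier[OF M, of s] mat_bigo_carrier[OF N, of s] by simp
qed

(* First-order expansion f = M0 + M1 + O(e^2) with M1 = O(e). *)
definition expands :: "('s \<Rightarrow> complex mat) \<Rightarrow> complex mat \<Rightarrow> ('s \<Rightarrow> complex mat) \<Rightarrow> bool" where
  "expands f M0 M1 \<longleftrightarrow> (\<forall>s. f s \<in> carrier_mat d d) \<and> M0 \<in> carrier_mat d d \<and>
     mat_bigo 1 M1 \<and> mat_bigo 2 (\<lambda>s. f s - (M0 + M1 s))"

lemma expands_mult:
  assumes f: "expands f M0 M1" and g: "expands g N0 N1"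
  shows "expands (\<lambda>s. f s * g s) (M0 * N0) (\<lambda>s. M0 * N1 s + M1 s * N0)"
proof -
  have c0: "M0 \<in> carrier_mat d d" "N0 \<in> carrier_mat d d"
    and c: "f s \<in> carrier_mat d d" "g s \<in> carrier_mat d d"
      "M1 s \<in> carrier_mat d d" "N1 s \<in> carrier_mat d d" for s
    using f g by (auto simp: expands_def mat_bigo_carrier)
  have bigos: "mat_bigo 1 M1" "mat_bigo 1 N1" "mat_bigo 2 (\<lambda>s. f s - (M0 + M1 s))"
    "mat_bigo 2 (\<lambda>s. g s - (N0 + N1 s))"
    using f g by (auto simp: expands_def)
  have 1: "mat_bigo 1 (\<lambda>s. M0 * N1 s + M1 s * N0)"
    using mat_bigo_mult[OF mat_bigo_const[OF c0(1)] bigos(2)]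
      mat_bigo_mult[OF bigos(1) mat_bigo_const[OF c0(2)]]
    by (intro mat_bigo_add) simp_all
  have M: "mat_bigo 0 (\<lambda>s. M0 + M1 s)"
    using mat_bigo_const[OF c0(1)] bigos(1) by (intro mat_bigo_add) (auto dest: mat_bigo_Suc[of 0, simplified])
  have N: "mat_bigo 0 (\<lambda>s. N0 + N1 s)"
    using mat_bigo_const[OF c0(2)] bigos(2) by (intro mat_bigo_add) (auto dest: mat_bigo_Suc[of 0, simplified])
  have "mat_bigo 0 (\<lambda>s. g s - (N0 + N1 s))"
    using bigos(4) by (auto simp: numeral_2_eq_2 dest!: mat_bigo_Suc)
  from mat_bigo_add[OF this N] have "mat_bigo 0 (\<lambda>s. g s - (N0 + N1 s) + (N0 + N1 s))" .
  also have "(\<lambda>s. g s - (N0 + N1 s) + (N0 + N1 s)) = g"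
  proof
    fix s show "g s - (N0 + N1 s) + (N0 + N1 s) = g s" using c[of s] c0 by (intro eq_matI) auto
  qed
  finally have g0: "mat_bigo 0 g" .
  \<comment> \<open>With \<open>f1 = M0 + M1\<close> and \<open>g1 = N0 + N1\<close>, the remainder
    of the product is \<open>(f - f1) * g + f1 * (g - g1) + M1 * N1\<close>. Every term is of second
    order, because \<open>g\<close> and \<open>f1\<close> are bounded and \<open>M1\<close>,
    \<open>N1\<close> are both of first order.\<close>
  have "mat_bigo 2 (\<lambda>s. ((f s - (M0 + M1 s)) * g s + (M0 + M1 s) * (g s - (N0 + N1 s))) + M1 s * N1 s)"
    using mat_bigo_mult[OF bigos(3) g0] mat_bigo_mult[OF M bigos(4)] mat_bigo_mult[OF bigos(1,2)]
    by (intro mat_bigo_add) (simp_all add: numeral_2_eq_2)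
  also have "(\<lambda>s. ((f s - (M0 + M1 s)) * g s + (M0 + M1 s) * (g s - (N0 + N1 s))) + M1 s * N1 s)
     = (\<lambda>s. f s * g s - (M0 * N0 + (M0 * N1 s + M1 s * N0)))"
  proof
    fix s
    show "((f s - (M0 + M1 s)) * g s + (M0 + M1 s) * (g s - (N0 + N1 s))) + M1 s * N1 s
       = f s * g s - (M0 * N0 + (M0 * N1 s + M1 s * N0))"
    proof (rule eq_matI)
      fix i j assume "i < dim_row (f s * g s - (M0 * N0 + (M0 * N1 s + M1 s * N0)))"
        "j < dim_col (f s * g s - (M0 * N0 + (M0 * N1 s + M1 s * N0)))"
      hence ij: "i < d" "j < d" using c[of s] c0 by auto
      have I: "(A * B) $$ (i,j) = (\<Sum>k<d. A $$ (i,k) * B $$ (k,j))"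
        if "A \<in> carrier_mat d d" "B \<in> carrier_mat d d" for A B :: "complex mat"
        using that ij by (rule index_mult_mat_sum)
      show "(((f s - (M0 + M1 s)) * g s + (M0 + M1 s) * (g s - (N0 + N1 s))) + M1 s * N1 s) $$ (i,j)
          = (f s * g s - (M0 * N0 + (M0 * N1 s + M1 s * N0))) $$ (i,j)"
      proof -
        have cc: "f s - (M0 + M1 s) \<in> carrier_mat d d" "M0 + M1 s \<in> carrier_mat d d"
          "g s - (N0 + N1 s) \<in> carrier_mat d d"
          using c[of s] c0 by auto
        have "(((f s - (M0 + M1 s)) * g s + (M0 + M1 s) * (g s - (N0 + N1 s))) + M1 s * N1 s) $$ (i,j)
            = ((f s - (M0 + M1 s)) * g s) $$ (i,j) + ((M0 + M1 s) * (g s - (N0 + N1 s))) $$ (i,j)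
              + (M1 s * N1 s) $$ (i,j)"
          using ij c[of s] c0 by (simp del: index_mult_mat(1))
        also have "\<dots> = (\<Sum>k<d. (f s - (M0 + M1 s)) $$ (i,k) * g s $$ (k,j)
              + (M0 + M1 s) $$ (i,k) * (g s - (N0 + N1 s)) $$ (k,j) + M1 s $$ (i,k) * N1 s $$ (k,j))"
          unfolding sum.distrib I[OF cc(1) c(2)] I[OF cc(2,3)] I[OF c(3,4)] ..
        also have "\<dots> = (\<Sum>k<d. f s $$ (i,k) * g s $$ (k,j) - (M0 $$ (i,k) * N0 $$ (k,j)
              + (M0 $$ (i,k) * N1 s $$ (k,j) + M1 s $$ (i,k) * N0 $$ (k,j))))"
          using ij c[of s] c0 by (intro sum.cong refl) (simp add: algebra_simps)
        also have "\<dots> = (f s * g s) $$ (i,j) - ((M0 * N0) $$ (i,j)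
              + ((M0 * N1 s) $$ (i,j) + (M1 s * N0) $$ (i,j)))"
          unfolding sum.distrib sum_subtractf I[OF c(1,2)] I[OF c0] I[OF c0(1) c(4)] I[OF c(3) c0(2)] ..
        finally show ?thesis using ij c[of s] c0 by (simp del: index_mult_mat(1))
      qed
    qed (use c[of s] c0 in auto)
  qed
  finally show ?thesis
    unfolding expands_def using c0 1 mult_carrier_mat[OF c(1) c(2)] by auto
qed

text \<open>The recursion of \<open>dpow\<close> is the product rule for \<open>f^k * f\<close>, so
  \<open>expands_mult\<close> is the whole induction step.\<close>

lemma expands_pow:
  assumes f: "expands f M0 M1"
  shows "expands (\<lambda>s. f s ^\<^sub>m k) (M0 ^\<^sub>m k) (\<lambda>s. dpow M0 (M1 s) k)"
proof (induction k)
  case 0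
  have c: "dim_row (f s) = d" "dim_row M0 = d" for s using f unfolding expands_def by auto
  have "1\<^sub>m d - (1\<^sub>m d + 0\<^sub>m d d) = (0\<^sub>m d d :: complex mat)" by (intro eq_matI) auto
  thus ?case using c by (simp del: right_add_zero_mat add: expands_def mat_bigo_def)
next
  case (Suc k)
  show ?case using expands_mult[OF Suc f] by simp
qed

lemma expands_one:
  assumes f: "expands f (1\<^sub>m d) M1" and M1: "mat_bigo 2 M1"
  shows "mat_bigo 2 (\<lambda>s. f s - 1\<^sub>m d)"
proof -
  have c: "f s \<in> carrier_mat d d" "M1 s \<in> carrier_mat d d" for s
    using f by (auto simp: expands_def mat_bigo_carrier)
  have "mat_bigo 2 (\<lambda>s. f s - (1\<^sub>m d + M1 s) + M1 s)"
    using f M1 by (intro mat_bigo_add) (auto simp: expands_def)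
  also have "(\<lambda>s. f s - (1\<^sub>m d + M1 s) + M1 s) = (\<lambda>s. f s - 1\<^sub>m d)"
  proof
    fix s show "f s - (1\<^sub>m d + M1 s) + M1 s = f s - 1\<^sub>m d" using c[of s] by (intro eq_matI) auto
  qed
  finally show ?thesis .
qed

section \<open>Second-order estimates: determinant and trace, then the word\<close>

lemma prod_one_plus_bigo:
  assumes "finite I" "\<And>i. i \<in> I \<Longrightarrow> h i \<in> O[F](e)"
  shows "(\<lambda>s. (\<Prod>i\<in>I. 1 + h i s) - 1 - (\<Sum>i\<in>I. h i s)) \<in> O[F](\<lambda>s. (e s)\<^sup>2)"
  using assms
proof (induction I rule: finite_induct)
  case (insert a I)
  define R where "R = (\<lambda>s. (\<Prod>i\<in>I. 1 + h i s) - 1 - (\<Sum>i\<in>I. h i s))"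
  have R: "R \<in> O[F](\<lambda>s. (e s)\<^sup>2)" unfolding R_def using insert by auto
  have a: "h a \<in> O[F](e)" using insert.prems by auto
  \<comment> \<open>If the product over \<open>I\<close> is \<open>1 + S + R\<close>, with
    \<open>S\<close> the sum, then the extra factor \<open>1 + h a\<close> leaves the new remainder
    \<open>h a * S + (1 + h a) * R\<close>.\<close>
  have "(\<lambda>s. h a s * (\<Sum>i\<in>I. h i s)) \<in> O[F](\<lambda>s. e s * e s)"
    by (intro landau_o.big.mult big_sum_in_bigo insert.prems) auto
  moreover have "(\<lambda>s. (1 + h a s) * R s) \<in> O[F](\<lambda>s. 1 * (e s)\<^sup>2)"
    by (intro landau_o.big.mult sum_in_bigo R bigo_e_1[OF a]) auto
  ultimately have "(\<lambda>s. h a s * (\<Sum>i\<in>I. h i s) + (1 + h a s) * R s) \<in> O[F](\<lambda>s. (e s)\<^sup>2)"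
    by (intro sum_in_bigo) (auto simp: power2_eq_square)
  also have "(\<lambda>s. h a s * (\<Sum>i\<in>I. h i s) + (1 + h a s) * R s) =
     (\<lambda>s. (\<Prod>i\<in>insert a I. 1 + h i s) - 1 - (\<Sum>i\<in>insert a I. h i s))"
    using insert.hyps by (auto simp: R_def algebra_simps)
  finally show ?case .
qed simp

text \<open>Meant for the terms of the Leibniz formula that belong to non-identity permutations: two
  small factors yield the order, and the remaining ones just have to stay bounded.\<close>

lemma prod_two_small_bigo:
  assumes I: "finite I" and a: "a \<in> I" "b \<in> I" "a \<noteq> b"
    and small: "h a \<in> O[F](e)" "h b \<in> O[F](e)" and bdd: "\<And>i. i \<in> I \<Longrightarrow> h i \<in> O[F](\<lambda>_. 1)"
  shows "(\<lambda>s. \<Prod>i\<in>I. h i s) \<in> O[F](\<lambda>s. (e s)\<^sup>2)"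
proof -
  have "(\<lambda>s. \<Prod>i\<in>I - {a} - {b}. h i s) \<in> O[F](\<lambda>s. \<Prod>i\<in>I - {a} - {b}. 1)"
    by (intro landau_o.big_prod) (use bdd in auto)
  hence "(\<lambda>s. h a s * (h b s * (\<Prod>i\<in>I - {a} - {b}. h i s))) \<in> O[F](\<lambda>s. e s * (e s * 1))"
    using small by (intro landau_o.big.mult) simp_all
  also have "(\<lambda>s. h a s * (h b s * (\<Prod>i\<in>I - {a} - {b}. h i s))) = (\<lambda>s. \<Prod>i\<in>I. h i s)"
    using a I by (intro ext) (simp add: prod.remove[of I a] prod.remove[of "I - {a}" b])
  finally show ?thesis by (simp add: power2_eq_square)
qed

text \<open>In the Leibniz formula for \<open>det (1 + H)\<close> the identity permutation
  contributes \<open>1 + tr H\<close> up to second order. Every other permutation moves at least two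
  points and so picks two small off-diagonal entries. As the determinant is exactly 1, the trace
  must itself be of second order.\<close>

lemma trace_bigo_of_det:
  assumes H: "mat_bigo 1 H" and det: "\<And>s. Determinant.det (1\<^sub>m d + H s) = 1"
  shows "(\<lambda>s. \<Sum>c<d. H s $$ (c,c)) \<in> O[F](\<lambda>s. (e s)\<^sup>2)"
proof -
  let ?I = "{0..<d}"
  let ?f = "\<lambda>p s. \<Prod>i\<in>?I. (1\<^sub>m d + H s) $$ (i, p i)"
  define T where "T = {p. p permutes ?I} - {id}"
  have carr: "H s \<in> carrier_mat d d" for s using mat_bigo_carrier[OF H] .
  have small: "(\<lambda>s. H s $$ (i,j)) \<in> O[F](e)" if "i < d" "j < d" for i j
    using mat_bigo_entry[OF H that] by simp
  have entry: "(1\<^sub>m d + H s) $$ (i,j) = (if i = j then 1 else 0) + H s $$ (i,j)"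
    if "i < d" "j < d" for i j s
    using carr[of s] that by simp
  have fin: "finite {p. p permutes ?I}" by (simp add: finite_permutations)
  have nonid: "?f p \<in> O[F](\<lambda>s. (e s)\<^sup>2)" if "p \<in> T" for p
  proof -
    have p: "p permutes ?I" "p \<noteq> id" using that by (auto simp: T_def)
    then obtain a where a: "p a \<noteq> a" by (auto simp: fun_eq_iff)
    hence aI: "a < d" using permutes_not_in[OF p(1), of a] by force
    have pI: "i < d \<Longrightarrow> p i < d" for i using permutes_in_image[OF p(1), of i] by auto
    \<comment> \<open>By injectivity \<open>p a\<close> is moved as well, so rows \<open>a\<close>
      and \<open>p a\<close> supply the two off-diagonal factors.\<close>
    have ppa: "p (p a) \<noteq> p a" using a permutes_inj[OF p(1)] by (auto dest: injD)
    show ?thesis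
    proof (rule prod_two_small_bigo[of _ a "p a"])
      show "(\<lambda>s. (1\<^sub>m d + H s) $$ (a, p a)) \<in> O[F](e)"
        using small[of a "p a"] a aI pI by (simp add: entry)
      show "(\<lambda>s. (1\<^sub>m d + H s) $$ (p a, p (p a))) \<in> O[F](e)"
        using small[of "p a" "p (p a)"] ppa aI pI by (simp add: entry)
      fix i assume "i \<in> ?I"
      hence i: "i < d" by simp
      have "(\<lambda>s. (if i = p i then 1 else 0) + H s $$ (i, p i)) \<in> O[F](\<lambda>_. 1)"
        using bigo_e_1[OF small[of i "p i"]] i pI[of i] by (intro sum_in_bigo) auto
      thus "(\<lambda>s. (1\<^sub>m d + H s) $$ (i, p i)) \<in> O[F](\<lambda>_. 1)" using i pI by (simp add: entry)
    qed (use a aI pI in auto)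
  qed
  have A: "(\<lambda>s. \<Sum>p\<in>T. signof p * ?f p s) \<in> O[F](\<lambda>s. (e s)\<^sup>2)"
    by (intro big_sum_in_bigo) (use nonid in \<open>auto simp: landau_o.big.cmult_in_iff sign_def\<close>)
  have B: "(\<lambda>s. (\<Prod>i\<in>?I. 1 + H s $$ (i,i)) - 1 - (\<Sum>i\<in>?I. H s $$ (i,i))) \<in> O[F](\<lambda>s. (e s)\<^sup>2)"
    by (intro prod_one_plus_bigo) (use small in auto)
  have "(\<lambda>s. - (\<Sum>p\<in>T. signof p * ?f p s) - ((\<Prod>i\<in>?I. 1 + H s $$ (i,i)) - 1 - (\<Sum>i\<in>?I. H s $$ (i,i))))
      \<in> O[F](\<lambda>s. (e s)\<^sup>2)"
    by (rule sum_in_bigo(2)[OF _ B]) (use A in simp)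
  also have "(\<lambda>s. - (\<Sum>p\<in>T. signof p * ?f p s) - ((\<Prod>i\<in>?I. 1 + H s $$ (i,i)) - 1 - (\<Sum>i\<in>?I. H s $$ (i,i))))
      = (\<lambda>s. \<Sum>c<d. H s $$ (c,c))"
  proof
    fix s
    have "1 = (\<Sum>p | p permutes ?I. signof p * ?f p s)"
      using det[of s] carr[of s] by (simp add: det_def'[of _ d])
    also have "\<dots> = ?f id s + (\<Sum>p\<in>T. signof p * ?f p s)"
      unfolding T_def using fin by (subst sum.remove[of _ id]) (auto simp: permutes_id)
    also have "?f id s = (\<Prod>i\<in>?I. 1 + H s $$ (i,i))" by (intro prod.cong) (auto simp: entry)
    finally show "- (\<Sum>p\<in>T. signof p * ?f p s) - ((\<Prod>i\<in>?I. 1 + H s $$ (i,i)) - 1 - (\<Sum>i\<in>?I. H s $$ (i,i)))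
      = (\<Sum>c<d. H s $$ (c,c))" by (simp add: atLeast0LessThan algebra_simps)
  qed
  finally show ?thesis .
qed

end

text \<open>The constant term of the word is \<open>V^(d-1) * U * U^(d-1) * V\<close>, the identity,
  and \<open>J_word_derivative\<close> turns the first-order term into the two twirls, of second
  order by hypothesis. The hypotheses are symmetric under exchanging \<open>(A, U, D)\<close> with
  \<open>(B, V, G)\<close>, so both orders of the word are covered.\<close>

lemma (in first_order) J_word_bigo:
  assumes d: "d > 0"
    and U: "U ^\<^sub>m d = 1\<^sub>m d" and V: "V ^\<^sub>m d = 1\<^sub>m d"
    and A: "expands A U D" and B: "expands B V G"
    and twirl_V: "mat_bigo 2 (\<lambda>s. dpow V (dpow U (D s) d * V) d)"
    and twirl_U: "mat_bigo 2 (\<lambda>s. dpow U (dpow V (G s) d * U) d)"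
  shows "mat_bigo 2 (\<lambda>s. J_word d (A s) (B s) - 1\<^sub>m d)"
proof -
  let ?P = "\<lambda>s. dpow U (D s) d" and ?Q = "\<lambda>s. dpow V (G s) d"
  have c0: "U \<in> carrier_mat d d" "V \<in> carrier_mat d d"
    and c: "D s \<in> carrier_mat d d" "G s \<in> carrier_mat d d" for s
    using A B by (auto simp: expands_def mat_bigo_carrier)
  have PQ: "?P s \<in> carrier_mat d d" "?Q s \<in> carrier_mat d d" for s
    using c0 c[of s] by (auto intro: dpow_carrier)
  have AB: "expands (\<lambda>s. A s ^\<^sub>m d * B s) V (\<lambda>s. G s + ?P s * V)"
    using expands_mult[OF expands_pow[OF A, of d] B] c0 left_mult_one_mat[OF c(2)] U by simp
  have BA: "expands (\<lambda>s. B s ^\<^sub>m d * A s) U (\<lambda>s. D s + ?Q s * U)"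
    using expands_mult[OF expands_pow[OF B, of d] A] c0 left_mult_one_mat[OF c(1)] V by simp
  have Uu: "U * U ^\<^sub>m (d - 1) = 1\<^sub>m d"
    using pow_mat_Suc_left[OF c0(1), of "d - 1"] U d by simp
  have vV: "V ^\<^sub>m (d - 1) * V = 1\<^sub>m d" using V d by (cases d) auto
  have vUu: "V ^\<^sub>m (d - 1) * U * U ^\<^sub>m (d - 1) = V ^\<^sub>m (d - 1)"
    using c0 Uu by (simp add: assoc_mult_mat[of _ d d _ d _ d])
  have v: "V ^\<^sub>m (d - 1) \<in> carrier_mat d d" using c0 by simp
  have J: "expands (\<lambda>s. J_word d (A s) (B s)) (1\<^sub>m d)
     (\<lambda>s. dpow V (?P s * V) d + V ^\<^sub>m (d - 1) * dpow U (?Q s * U) d * V)"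
    using expands_mult[OF expands_mult[OF expands_mult[OF expands_pow[OF AB, of "d - 1"] A]
        expands_pow[OF BA, of "d - 1"]] B]
    unfolding J_word_def vUu vV using J_word_derivative[OF d c0 c U V] by simp
  have "mat_bigo 2 (\<lambda>s. dpow V (?P s * V) d + V ^\<^sub>m (d - 1) * dpow U (?Q s * U) d * V)"
    using mat_bigo_mult[OF mat_bigo_mult[OF mat_bigo_const[OF v] twirl_U] mat_bigo_const[OF c0(2)]] twirl_V
    by (intro mat_bigo_add) (simp_all add: numeral_2_eq_2)
  from expands_one[OF J this] show ?thesis .
qed

section \<open>Entries of products with clock and shift\<close>

lemma omega_cis: "omega d ^ k = cis (2 * pi * real k / real d)"
proof -
  have "omega d = cis (2 * pi / real d)" by (simp add: omega_def cis_conv_exp algebra_simps)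
  thus ?thesis by (simp add: DeMoivre algebra_simps)
qed

lemma omega_root: "d > 0 \<Longrightarrow> (omega d ^ k) ^ d = 1"
  unfolding omega_cis DeMoivre by (simp add: cis_multiple_2pi)

lemma omega_inj: "a < d \<Longrightarrow> b < d \<Longrightarrow> omega d ^ a = omega d ^ b \<Longrightarrow> a = b"
  using bij_betw_imp_inj_on[OF bij_betw_roots_unity[of d]] by (auto simp: omega_cis inj_on_def)

context
  fixes d :: nat
  assumes d: "d > 0"
begin

lemma clock_mat_carrier: "clock_mat d \<in> carrier_mat d d"
  and shift_mat_carrier: "shift_mat d \<in> carrier_mat d d"
  by (simp_all add: clock_mat_def shift_mat_def)

lemma index_clock_mult:
  assumes "M \<in> carrier_mat d d" "a < d" "b < d"
  shows "(clock_mat d * M) $$ (a,b) = omega d ^ a * M $$ (a,b)"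
proof -
  have "(clock_mat d * M) $$ (a,b) = (\<Sum>k<d. if k = a then omega d ^ a * M $$ (a,b) else 0)"
    unfolding index_mult_mat_sum[OF clock_mat_carrier assms]
    by (intro sum.cong) (use assms in \<open>auto simp: clock_mat_def\<close>)
  thus ?thesis using assms by simp
qed

lemma index_mult_clock:
  assumes "M \<in> carrier_mat d d" "a < d" "b < d"
  shows "(M * clock_mat d) $$ (a,b) = M $$ (a,b) * omega d ^ b"
proof -
  have "(M * clock_mat d) $$ (a,b) = (\<Sum>k<d. if k = b then M $$ (a,b) * omega d ^ b else 0)"
    unfolding index_mult_mat_sum[OF assms(1) clock_mat_carrier assms(2,3)]
    by (intro sum.cong) (use assms in \<open>auto simp: clock_mat_def\<close>)
  thus ?thesis using assms by simp
qed

text \<open>Row indices written as residues avoid a case split at the wrap-around and let the rule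
  be iterated to powers of the shift.\<close>

lemma index_shift_mult:
  assumes "M \<in> carrier_mat d d" "b < d"
  shows "(shift_mat d * M) $$ (Suc a mod d, b) = M $$ (a mod d, b)"
proof -
  have "(shift_mat d * M) $$ (Suc a mod d, b) = (\<Sum>k<d. if k = a mod d then M $$ (a mod d, b) else 0)"
  proof (subst index_mult_mat_sum[OF shift_mat_carrier assms(1)], goal_cases)
    case 3
    have "Suc a mod d = Suc k mod d \<longleftrightarrow> k = a mod d" if "k < d" for k
    proof
      assume "Suc a mod d = Suc k mod d"
      hence "a mod d = k mod d" by (metis nat_mod_eq_iff mod_Suc_eq mod_mod_trivial Suc_inject mod_Suc nat.distinct(1))
      thus "k = a mod d" using that by simp
    qed (simp add: mod_simps)
    thus ?case using d assms by (intro sum.cong) (auto simp: shift_mat_def)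
  qed (use d assms in auto)
  thus ?thesis using d by simp
qed

lemma index_mult_shift:
  assumes "M \<in> carrier_mat d d" "a < d"
  shows "(M * shift_mat d) $$ (a, b mod d) = M $$ (a, Suc b mod d)"
proof -
  have "(M * shift_mat d) $$ (a, b mod d) = (\<Sum>k<d. if k = Suc b mod d then M $$ (a, Suc b mod d) else 0)"
  proof (subst index_mult_mat_sum[OF assms(1) shift_mat_carrier assms(2)], goal_cases)
    case 2
    show ?case using d assms by (intro sum.cong) (auto simp: shift_mat_def mod_simps)
  qed (use d in auto)
  thus ?thesis using d by simp
qed

lemma index_clock_pow_mult:
  assumes "M \<in> carrier_mat d d" "a < d" "b < d"
  shows "(clock_mat d ^\<^sub>m k * M) $$ (a,b) = (omega d ^ a) ^ k * M $$ (a,b)"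
  using assms
proof (induction k)
  case (Suc k)
  have "clock_mat d ^\<^sub>m Suc k * M = clock_mat d * (clock_mat d ^\<^sub>m k * M)"
    unfolding pow_mat_Suc_left[OF clock_mat_carrier]
    using Suc.prems clock_mat_carrier by (intro assoc_mult_mat[of _ d d _ d _ d]) auto
  moreover have "clock_mat d ^\<^sub>m k * M \<in> carrier_mat d d" using Suc.prems clock_mat_carrier by auto
  ultimately show ?case using Suc by (simp add: index_clock_mult)
qed (simp add: clock_mat_def)

lemma index_shift_pow_mult:
  assumes "M \<in> carrier_mat d d" "b < d"
  shows "(shift_mat d ^\<^sub>m k * M) $$ ((a + k) mod d, b) = M $$ (a mod d, b)"
  using assms
proof (induction k)
  case (Suc k)
  have "shift_mat d ^\<^sub>m Suc k * M = shift_mat d * (shift_mat d ^\<^sub>m k * M)"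
    unfolding pow_mat_Suc_left[OF shift_mat_carrier]
    using Suc.prems shift_mat_carrier by (intro assoc_mult_mat[of _ d d _ d _ d]) auto
  moreover have "shift_mat d ^\<^sub>m k * M \<in> carrier_mat d d" using Suc.prems shift_mat_carrier by auto
  ultimately show ?case using Suc by (simp add: index_shift_mult)
qed (simp add: shift_mat_def)

lemma clock_mat_pow: "clock_mat d ^\<^sub>m d = 1\<^sub>m d"
proof (rule eq_matI)
  fix a b assume "a < dim_row (1\<^sub>m d :: complex mat)" "b < dim_col (1\<^sub>m d :: complex mat)"
  hence ab: "a < d" "b < d" by auto
  have "(clock_mat d ^\<^sub>m d * 1\<^sub>m d) $$ (a,b) = 1\<^sub>m d $$ (a,b)"
    using index_clock_pow_mult[OF one_carrier_mat ab, of d] omega_root[OF d] by simp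
  thus "(clock_mat d ^\<^sub>m d) $$ (a,b) = 1\<^sub>m d $$ (a,b)"
    using clock_mat_carrier by (simp add: right_mult_one_mat[of _ d d])
qed (use clock_mat_carrier in auto)

lemma shift_mat_pow: "shift_mat d ^\<^sub>m d = 1\<^sub>m d"
proof (rule eq_matI)
  fix a b assume "a < dim_row (1\<^sub>m d :: complex mat)" "b < dim_col (1\<^sub>m d :: complex mat)"
  hence ab: "a < d" "b < d" by auto
  have "(shift_mat d ^\<^sub>m d * 1\<^sub>m d) $$ (a,b) = 1\<^sub>m d $$ (a,b)"
    using index_shift_pow_mult[OF one_carrier_mat ab(2), of d a] ab by simp
  thus "(shift_mat d ^\<^sub>m d) $$ (a,b) = 1\<^sub>m d $$ (a,b)"
    using shift_mat_carrier by (simp add: right_mult_one_mat[of _ d d])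
qed (use shift_mat_carrier in auto)

section \<open>Averages over clock and shift conjugations\<close>

lemma index_dpow_clock:
  assumes "M \<in> carrier_mat d d" "a < d" "b < d"
  shows "dpow (clock_mat d) M k $$ (a,b)
     = M $$ (a,b) * (\<Sum>i<k. (omega d ^ b) ^ (k - Suc i) * (omega d ^ a) ^ i)"
proof (induction k)
  case (Suc k)
  have "dpow (clock_mat d) M (Suc k) $$ (a,b)
      = (omega d ^ a) ^ k * M $$ (a,b) + dpow (clock_mat d) M k $$ (a,b) * omega d ^ b"
    using assms clock_mat_carrier dpow_carrier[OF clock_mat_carrier assms(1), of k]
    by (simp add: index_clock_pow_mult index_mult_clock del: index_mult_mat(1))
  also have "\<dots> = M $$ (a,b) * (\<Sum>i<Suc k. (omega d ^ b) ^ (k - i) * (omega d ^ a) ^ i)"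
  proof -
    \<comment> \<open>The factor from the right raises every exponent of \<open>omega d ^ b\<close>
      by one; for \<open>i < k\<close> the truncated subtraction respects this.\<close>
    have "(\<Sum>i<k. (omega d ^ b) ^ (k - i) * (omega d ^ a) ^ i)
        = (\<Sum>i<k. (omega d ^ b) ^ (k - Suc i) * (omega d ^ a) ^ i) * omega d ^ b"
      unfolding sum_distrib_right
    proof (intro sum.cong refl)
      fix i assume "i \<in> {..<k}"
      hence "k - i = Suc (k - Suc i)" by auto
      thus "(omega d ^ b) ^ (k - i) * (omega d ^ a) ^ i
        = (omega d ^ b) ^ (k - Suc i) * (omega d ^ a) ^ i * omega d ^ b" by simp
    qed
    thus ?thesis by (simp add: Suc.IH algebra_simps)
  qed
  finally show ?case by simp
qed (use assms in \<open>simp add: clock_mat_def\<close>)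

text \<open>The entry is multiplied by the sum of \<open>x^i * y^(d-1-i)\<close> for the
  \<open>d\<close>-th roots of unity \<open>x = omega^a\<close> and \<open>y = omega^b\<close>.
  Times \<open>x - y\<close> this sum is \<open>x^d - y^d = 0\<close>, so it vanishes when
  \<open>x\<close> and \<open>y\<close> differ; on the diagonal all \<open>d\<close> terms
  coincide.\<close>

lemma index_dpow_clock_period:
  assumes "M \<in> carrier_mat d d" "a < d" "b < d"
  shows "dpow (clock_mat d) M d $$ (a,b)
     = (if a = b then of_nat d * (omega d ^ a) ^ (d - 1) * M $$ (a,a) else 0)"
proof (cases "a = b")
  case True
  have "(\<Sum>i<d. (omega d ^ a) ^ (d - Suc i) * (omega d ^ a) ^ i) = (\<Sum>i<d. (omega d ^ a) ^ (d - 1))"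
    by (intro sum.cong) (auto simp flip: power_add)
  thus ?thesis using True index_dpow_clock[OF assms, of d] by simp
next
  case False
  have "(omega d ^ a - omega d ^ b) * (\<Sum>i<d. (omega d ^ b) ^ (d - Suc i) * (omega d ^ a) ^ i) = 0"
    unfolding power_diff_sumr2[symmetric] by (simp add: omega_root[OF d])
  hence "(\<Sum>i<d. (omega d ^ b) ^ (d - Suc i) * (omega d ^ a) ^ i) = 0"
    using omega_inj[OF assms(2,3)] False by auto
  thus ?thesis using False index_dpow_clock[OF assms, of d] by simp
qed

text \<open>The shift factors have total exponent \<open>k - 1\<close> in every summand, so all
  entries picked from \<open>M\<close> lie on one cyclic diagonal. The row is written as
  \<open>a + k\<close> so that the induction hypothesis, taken for all \<open>a\<close> and
  \<open>b\<close>, applies to the next place on that diagonal.\<close>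

lemma index_dpow_shift:
  assumes "M \<in> carrier_mat d d"
  shows "dpow (shift_mat d) M k $$ ((a + k) mod d, b mod d)
     = (\<Sum>i<k. M $$ ((Suc a + i) mod d, (b + i) mod d))"
proof (induction k arbitrary: a b)
  case (Suc k)
  have "dpow (shift_mat d) M (Suc k) $$ ((a + Suc k) mod d, b mod d)
      = (shift_mat d ^\<^sub>m k * M) $$ ((Suc a + k) mod d, b mod d)
        + (dpow (shift_mat d) M k * shift_mat d) $$ ((Suc a + k) mod d, b mod d)"
    using assms d shift_mat_carrier dpow_carrier[OF shift_mat_carrier assms, of k]
    by (simp del: index_mult_mat(1))
  also have "\<dots> = M $$ (Suc a mod d, b mod d) + dpow (shift_mat d) M k $$ ((Suc a + k) mod d, Suc b mod d)"
    using assms d index_mult_shift[OF dpow_carrier[OF shift_mat_carrier assms, of k], of "(Suc a + k) mod d" b]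
      index_shift_pow_mult[OF assms, of "b mod d" k "Suc a"]
    by (simp del: index_mult_mat(1))
  also have "\<dots> = (\<Sum>i<Suc k. M $$ ((Suc a + i) mod d, (b + i) mod d))"
    unfolding Suc.IH sum.lessThan_Suc_shift by simp
  finally show ?case .
qed (use d shift_mat_carrier in auto)

text \<open>Advancing the window by one exchanges \<open>g a\<close> for \<open>g (a + d)\<close>,
  and these agree by periodicity.\<close>

lemma sum_cyclic_shift:
  fixes g :: "nat \<Rightarrow> complex"
  assumes "\<And>c. g (c mod d) = g c"
  shows "(\<Sum>i<d. g (a + i)) = (\<Sum>c<d. g c)"
proof (induction a)
  case (Suc a)
  have "(\<Sum>i<d. g (Suc a + i)) + g a = (\<Sum>i<Suc d. g (a + i))"
    unfolding sum.lessThan_Suc_shift by simp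
  also have "\<dots> = (\<Sum>i<d. g (a + i)) + g a"
    using assms[of "a + d"] assms[of a] by simp
  finally show ?case using Suc by simp
qed simp

text \<open>As \<open>Z^d = 1\<close>, the extra factor \<open>Z\<close> makes the outer
  \<open>dpow\<close> the sum of \<open>Z^i P Z^(-i)\<close>, with \<open>P\<close> the inner
  \<open>dpow\<close>. This sum erases the off-diagonal part of \<open>P\<close> and multiplies the
  diagonal by \<open>d\<close>. Each diagonal entry of \<open>P\<close> is the sum of
  \<open>M\<close> over one cyclic diagonal, which is the trace of \<open>X^(-1) M\<close>.\<close>

lemma twirl_clock:
  assumes "M \<in> carrier_mat d d" "a < d" "b < d"
  shows "dpow (clock_mat d) (dpow (shift_mat d) M d * clock_mat d) d $$ (a,b)
     = (if a = b then of_nat d * (\<Sum>c<d. (shift_mat d ^\<^sub>m (d - 1) * M) $$ (c,c)) else 0)"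
proof (cases "a = b")
  case True
  let ?P = "dpow (shift_mat d) M d"
  have P: "?P \<in> carrier_mat d d" using shift_mat_carrier assms by (intro dpow_carrier)
  have PZ: "?P * clock_mat d \<in> carrier_mat d d" using P clock_mat_carrier by auto
  have "?P $$ (a,a) = (\<Sum>i<d. M $$ (Suc (a + i) mod d, (a + i) mod d))"
    using index_dpow_shift[OF assms(1), of d a a] assms by simp
  also have "\<dots> = (\<Sum>c<d. M $$ (Suc c mod d, c mod d))"
    by (rule sum_cyclic_shift[of "\<lambda>c. M $$ (Suc c mod d, c mod d)"]) (simp add: mod_simps)
  also have "\<dots> = (\<Sum>c<d. (shift_mat d ^\<^sub>m (d - 1) * M) $$ (c,c))"
  proof (intro sum.cong refl)
    fix c assume "c \<in> {..<d}"
    hence "c < d" by simp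
    \<comment> \<open>Row \<open>Suc c\<close> is carried by \<open>d - 1\<close> shifts to row
      \<open>Suc c + (d - 1)\<close>, which is \<open>c\<close> modulo \<open>d\<close>.\<close>
    thus "M $$ (Suc c mod d, c mod d) = (shift_mat d ^\<^sub>m (d - 1) * M) $$ (c,c)"
      using index_shift_pow_mult[OF assms(1), of c "d - 1" "Suc c"] d by simp
  qed
  finally have tr: "?P $$ (a,a) = (\<Sum>c<d. (shift_mat d ^\<^sub>m (d - 1) * M) $$ (c,c))" .
  have "(omega d ^ a) ^ (d - 1) * omega d ^ a = 1"
    using omega_root[OF d, of a] d by (cases d) (auto simp: mult.commute)
  thus ?thesis
    unfolding index_dpow_clock_period[OF PZ assms(2,3)] index_mult_clock[OF P assms(2,2)] tr
    using True by (simp del: index_mult_mat(1))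
next
  case False
  have "dpow (shift_mat d) M d * clock_mat d \<in> carrier_mat d d"
    using shift_mat_carrier clock_mat_carrier dpow_carrier[OF shift_mat_carrier assms(1), of d] by auto
  from index_dpow_clock_period[OF this assms(2,3)] False show ?thesis by simp
qed

text \<open>Here the clock acts first: \<open>Q\<close> is diagonal, with diagonal entries
  \<open>d\<close> times those of \<open>Z^(-1) M\<close>, which already accounts for the factor
  \<open>d\<close>. Conjugation by the shift permutes the diagonal cyclically, so the sum over a
  period puts the trace of \<open>Q\<close> in every diagonal place.\<close>

lemma twirl_shift:
  assumes "M \<in> carrier_mat d d" "a < d" "b < d"
  shows "dpow (shift_mat d) (dpow (clock_mat d) M d * shift_mat d) d $$ (a,b)
     = (if a = b then of_nat d * (\<Sum>c<d. (clock_mat d ^\<^sub>m (d - 1) * M) $$ (c,c)) else 0)"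
proof -
  let ?Q = "dpow (clock_mat d) M d"
  let ?g = "\<lambda>c. ?Q $$ (c mod d, c mod d)"
  have Q: "?Q \<in> carrier_mat d d" using clock_mat_carrier assms by (intro dpow_carrier)
  have QX: "?Q * shift_mat d \<in> carrier_mat d d" using Q shift_mat_carrier by auto
  have "dpow (shift_mat d) (?Q * shift_mat d) d $$ (a,b)
      = (\<Sum>i<d. (?Q * shift_mat d) $$ ((Suc a + i) mod d, (b + i) mod d))"
    using index_dpow_shift[OF QX, of d a b] assms by simp
  also have "\<dots> = (\<Sum>i<d. ?Q $$ ((Suc a + i) mod d, (Suc b + i) mod d))"
    using d by (intro sum.cong) (simp_all add: index_mult_shift[OF Q] del: index_mult_mat(1))
  also have "\<dots> = (if a = b then of_nat d * (\<Sum>c<d. (clock_mat d ^\<^sub>m (d - 1) * M) $$ (c,c)) else 0)"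
  proof (cases "a = b")
    case True
    have "(\<Sum>i<d. ?Q $$ ((Suc a + i) mod d, (Suc b + i) mod d)) = (\<Sum>c<d. ?g c)"
      unfolding True by (rule sum_cyclic_shift[of ?g]) simp
    also have "\<dots> = (\<Sum>c<d. of_nat d * (clock_mat d ^\<^sub>m (d - 1) * M) $$ (c,c))"
      by (intro sum.cong)
         (simp_all add: index_dpow_clock_period[OF assms(1)] index_clock_pow_mult[OF assms(1)] del: index_mult_mat(1))
    finally show ?thesis using True by (simp add: sum_distrib_left)
  next
    case False
    \<comment> \<open>Equal translates of distinct \<open>a, b < d\<close> stay distinct modulo
      \<open>d\<close>, so every entry of \<open>Q\<close> met here is off the diagonal and
      vanishes.\<close>
    have "(Suc a + i) mod d \<noteq> (Suc b + i) mod d" for i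
    proof
      assume eq: "(Suc a + i) mod d = (Suc b + i) mod d"
      show False
      proof (cases "a \<le> b")
        case True
        hence "d dvd b - a" using mod_eq_dvd_iff_nat[of "Suc a + i" "Suc b + i" d] eq by simp
        thus False using True False assms(2,3) by (auto dest: dvd_imp_le)
      next
        case False
        hence "d dvd a - b" using mod_eq_dvd_iff_nat[of "Suc b + i" "Suc a + i" d] eq by simp
        thus False using False assms(2,3) by (auto dest: dvd_imp_le)
      qed
    qed
    thus ?thesis using False d by (simp add: index_dpow_clock_period[OF assms(1)])
  qed
  finally show ?thesis .
qed

end

section \<open>The perturbed pair and uniform bounds\<close>

lemma (in first_order) expands_perturbation:
  assumes "\<And>s. A s \<in> carrier_mat d d" "M \<in> carrier_mat d d"
    and close: "\<And>s i j. i < d \<Longrightarrow> j < d \<Longrightarrow> cmod ((A s - M) $$ (i,j)) \<le> cmod (e s)"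
  shows "expands A M (\<lambda>s. A s - M)"
proof -
  have "(\<lambda>s. (A s - M) $$ (i,j)) \<in> O[F](e)" if "i < d" "j < d" for i j
    using close[OF that] by (intro bigoI[of _ 1]) (auto intro: always_eventually)
  \<comment> \<open>The whole difference is taken as the first-order part, so the remainder is
    exactly zero.\<close>
  moreover have "A s - (M + (A s - M)) = 0\<^sub>m d d" for s
    using assms(1)[of s] assms(2) by (intro eq_matI) auto
  moreover have "A s - M \<in> carrier_mat d d" for s
    using assms(1)[of s] assms(2) by auto
  ultimately show ?thesis using assms(1,2) by (simp add: expands_def mat_bigo_def)
qed

text \<open>\<open>M^(d-1)\<close> is the inverse of \<open>M\<close>, so
  \<open>M^(d-1) * A = 1 + H\<close> with \<open>H = M^(d-1) * (A - M)\<close>. Equal determinants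
  give \<open>det (1 + H) = 1\<close>, and \<open>trace_bigo_of_det\<close> applies.\<close>

lemma (in first_order) trace_bigo_perturbation:
  assumes d: "d > 0" and A: "expands A M (\<lambda>s. A s - M)"
    and det: "\<And>s. Determinant.det (A s) = Determinant.det M" and one: "M ^\<^sub>m d = 1\<^sub>m d"
  shows "(\<lambda>s. \<Sum>c<d. (M ^\<^sub>m (d - 1) * (A s - M)) $$ (c,c)) \<in> O[F](\<lambda>s. (e s)\<^sup>2)"
proof (rule trace_bigo_of_det)
  have M: "M \<in> carrier_mat d d" and AM: "mat_bigo 1 (\<lambda>s. A s - M)" and c: "A s \<in> carrier_mat d d" for s
    using A by (auto simp: expands_def)
  have m: "M ^\<^sub>m (d - 1) \<in> carrier_mat d d" using M by simp
  show "mat_bigo 1 (\<lambda>s. M ^\<^sub>m (d - 1) * (A s - M))"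
    using mat_bigo_mult[OF mat_bigo_const[OF m] AM] by simp
  fix s
  have mM: "M ^\<^sub>m (d - 1) * M = 1\<^sub>m d" using one d by (cases d) auto
  have AM': "A s - M \<in> carrier_mat d d" using AM by (rule mat_bigo_carrier)
  have "M + (A s - M) = A s" using M c[of s] by (intro eq_matI) auto
  hence "1\<^sub>m d + M ^\<^sub>m (d - 1) * (A s - M) = M ^\<^sub>m (d - 1) * A s"
    using mult_add_distrib_mat[OF m M AM'] mM by simp
  also have "Determinant.det \<dots> = Determinant.det (M ^\<^sub>m (d - 1) * M)"
    using det_mult[OF m c] det_mult[OF m M] det by simp
  finally show "Determinant.det (1\<^sub>m d + M ^\<^sub>m (d - 1) * (A s - M)) = 1" using mM by simp
qed

text \<open>For \<open>F = top\<close>, "eventually" means "for every \<open>s\<close>", so the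
  Landau constant of the sum of the entry moduli is a uniform bound, and that sum dominates the
  operator norm.\<close>

lemma (in first_order) op_norm_bigo:
  assumes M: "mat_bigo 2 M" and F: "F = Orderings.top"
  shows "\<exists>C>0. \<forall>s. op_norm_mat (M s) \<le> C * (cmod (e s))\<^sup>2"
proof -
  have "(\<lambda>s. \<Sum>i<d. \<Sum>j<d. complex_of_real (cmod (M s $$ (i,j)))) \<in> O[F](\<lambda>s. (e s)\<^sup>2)"
  proof (intro big_sum_in_bigo)
    fix i j assume "i \<in> {..<d}" "j \<in> {..<d}"
    hence "(\<lambda>s. M s $$ (i,j)) \<in> O[F](\<lambda>s. (e s)\<^sup>2)" using mat_bigo_entry[OF M] by simp
    moreover have "(\<lambda>s. complex_of_real (cmod (M s $$ (i,j)))) \<in> O[F](\<lambda>s. M s $$ (i,j))"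
      by (intro bigoI[of _ 1]) simp
    ultimately show "(\<lambda>s. complex_of_real (cmod (M s $$ (i,j)))) \<in> O[F](\<lambda>s. (e s)\<^sup>2)"
      using landau_o.big.trans by blast
  qed
  then obtain C where C: "C > 0"
    "\<And>s. cmod (\<Sum>i<d. \<Sum>j<d. complex_of_real (cmod (M s $$ (i,j)))) \<le> C * cmod ((e s)\<^sup>2)"
    unfolding F by (elim landau_o.bigE) (auto simp: eventually_top)
  have "op_norm_mat (M s) \<le> C * (cmod (e s))\<^sup>2" for s
  proof -
    have "op_norm_mat (M s) \<le> (\<Sum>i<d. \<Sum>j<d. cmod (M s $$ (i,j)))"
      using op_norm_mat_le_sum_entries[of "M s"] mat_bigo_carrier[OF M, of s] by simp
    also have "\<dots> \<le> cmod (complex_of_real (\<Sum>i<d. \<Sum>j<d. cmod (M s $$ (i,j))))"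
      unfolding norm_of_real by (rule abs_ge_self)
    also have "\<dots> \<le> C * cmod ((e s)\<^sup>2)" using C(2)[of s] by simp
    finally show ?thesis by (simp add: norm_power)
  qed
  with C(1) show ?thesis by blast
qed

theorem lemma4p2:
  fixes d :: nat
  assumes "d \<ge> 2"
  shows
    "(\<exists>\<epsilon>\<^sub>0 > (0::real). \<exists>C > (0::real). \<forall>(\<epsilon>::real) X' Z'.
        0 \<le> \<epsilon> \<longrightarrow> \<epsilon> < \<epsilon>\<^sub>0 \<longrightarrow>
        X' \<in> carrier_mat d d \<longrightarrow> Z' \<in> carrier_mat d d \<longrightarrow>
        unitary_mat X' \<longrightarrow> unitary_mat Z' \<longrightarrow>
        Determinant.det X' = Determinant.det (shift_mat d) \<longrightarrow>
        Determinant.det Z' = Determinant.det (clock_mat d) \<longrightarrow>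
        op_norm_mat (X' - shift_mat d) \<le> \<epsilon> \<longrightarrow>
        op_norm_mat (Z' - clock_mat d) \<le> \<epsilon> \<longrightarrow>
        op_norm_mat (J_word d X' Z' - 1\<^sub>m d) \<le> C * \<epsilon>\<^sup>2)
     \<and>
     (\<exists>\<epsilon>\<^sub>0 > (0::real). \<exists>C > (0::real). \<forall>(\<epsilon>::real) X' Z'.
        0 \<le> \<epsilon> \<longrightarrow> \<epsilon> < \<epsilon>\<^sub>0 \<longrightarrow>
        X' \<in> carrier_mat d d \<longrightarrow> Z' \<in> carrier_mat d d \<longrightarrow>
        unitary_mat X' \<longrightarrow> unitary_mat Z' \<longrightarrow>
        Determinant.det X' = Determinant.det (shift_mat d) \<longrightarrow>
        Determinant.det Z' = Determinant.det (clock_mat d) \<longrightarrow>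
        op_norm_mat (X' - shift_mat d) \<le> \<epsilon> \<longrightarrow>
        op_norm_mat (Z' - clock_mat d) \<le> \<epsilon> \<longrightarrow>
        op_norm_mat (J_word d Z' X' - 1\<^sub>m d) \<le> C * \<epsilon>\<^sup>2)"
proof -
  have d: "d > 0" using assms by simp
  let ?X = "shift_mat d" and ?Z = "clock_mat d"
  (* Replacing inadmissible data by the unperturbed pair makes the hypotheses hold for every s. *)
  define good where "good = (\<lambda>(\<epsilon>::real, X', Z').
    0 \<le> \<epsilon> \<and> \<epsilon> < 1 \<and> X' \<in> carrier_mat d d \<and> Z' \<in> carrier_mat d d \<and>
    Determinant.det X' = Determinant.det ?X \<and> Determinant.det Z' = Determinant.det ?Z \<and>
    op_norm_mat (X' - ?X) \<le> \<epsilon> \<and> op_norm_mat (Z' - ?Z) \<le> \<epsilon>)"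
  define e where "e s = complex_of_real (if good s then fst s else 0)" for s
  define A where "A s = (if good s then fst (snd s) else ?X)" for s
  define B where "B s = (if good s then snd (snd s) else ?Z)" for s
  \<comment> \<open>The cut-off \<open>1\<close> in \<open>good\<close> bounds \<open>e\<close>; it
    returns below as the witness for the threshold on \<epsilon>.\<close>
  interpret first_order d Orderings.top e
  proof
    show "e \<in> O[Orderings.top](\<lambda>_. 1)"
      by (intro bigoI[of _ 1] always_eventually) (auto simp: e_def good_def)
  qed
  note XZ = shift_mat_carrier[OF d] clock_mat_carrier[OF d]
  note pow = shift_mat_pow[OF d] clock_mat_pow[OF d]
  have A: "expands A ?X (\<lambda>s. A s - ?X)"
  proof (rule expands_perturbation)
    show "A s \<in> carrier_mat d d" for s using XZ by (auto simp: A_def good_def)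
    fix s i j assume "i < d" "j < d"
    hence "cmod ((A s - ?X) $$ (i,j)) \<le> op_norm_mat (A s - ?X)" if "good s"
      using XZ by (intro entry_le_op_norm_mat) auto
    \<comment> \<open>For good data the operator norm bounds every entry; for the default pair both
      sides are zero.\<close>
    thus "cmod ((A s - ?X) $$ (i,j)) \<le> cmod (e s)"
      using XZ \<open>i < d\<close> \<open>j < d\<close> by (cases "good s") (auto simp: A_def e_def good_def)
  qed (rule XZ)
  have B: "expands B ?Z (\<lambda>s. B s - ?Z)"
  proof (rule expands_perturbation)
    show "B s \<in> carrier_mat d d" for s using XZ by (auto simp: B_def good_def)
    fix s i j assume "i < d" "j < d"
    hence "cmod ((B s - ?Z) $$ (i,j)) \<le> op_norm_mat (B s - ?Z)" if "good s"
      using XZ by (intro entry_le_op_norm_mat) auto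
    thus "cmod ((B s - ?Z) $$ (i,j)) \<le> cmod (e s)"
      using XZ \<open>i < d\<close> \<open>j < d\<close> by (cases "good s") (auto simp: B_def e_def good_def)
  qed (rule XZ)
  have c: "A s - ?X \<in> carrier_mat d d" "B s - ?Z \<in> carrier_mat d d" for s
    using A B by (auto simp: expands_def mat_bigo_carrier)
  have trA: "(\<lambda>s. \<Sum>c<d. (?X ^\<^sub>m (d - 1) * (A s - ?X)) $$ (c,c)) \<in> O[Orderings.top](\<lambda>s. (e s)\<^sup>2)"
    by (rule trace_bigo_perturbation[OF d A _ pow(1)]) (auto simp: A_def good_def)
  have trB: "(\<lambda>s. \<Sum>c<d. (?Z ^\<^sub>m (d - 1) * (B s - ?Z)) $$ (c,c)) \<in> O[Orderings.top](\<lambda>s. (e s)\<^sup>2)"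
    by (rule trace_bigo_perturbation[OF d B _ pow(2)]) (auto simp: B_def good_def)
  have tZ: "mat_bigo 2 (\<lambda>s. dpow ?Z (dpow ?X (A s - ?X) d * ?Z) d)"
    unfolding mat_bigo_def
  proof (intro conjI allI impI)
    fix s show "dpow ?Z (dpow ?X (A s - ?X) d * ?Z) d \<in> carrier_mat d d"
      by (intro dpow_carrier mult_carrier_mat[of _ d d] XZ c)
  next
    fix i j assume "i < d" "j < d"
    \<comment> \<open>The diagonal entries are \<open>d\<close> times the trace estimated in
      \<open>trA\<close>, and the others are zero.\<close>
    from twirl_clock[OF d c(1) this] trA
    show "(\<lambda>s. dpow ?Z (dpow ?X (A s - ?X) d * ?Z) d $$ (i,j)) \<in> O[Orderings.top](\<lambda>s. e s ^ 2)"
      by (cases "i = j") (auto simp del: index_mult_mat(1))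
  qed
  have tX: "mat_bigo 2 (\<lambda>s. dpow ?X (dpow ?Z (B s - ?Z) d * ?X) d)"
    unfolding mat_bigo_def
  proof (intro conjI allI impI)
    fix s show "dpow ?X (dpow ?Z (B s - ?Z) d * ?X) d \<in> carrier_mat d d"
      by (intro dpow_carrier mult_carrier_mat[of _ d d] XZ c)
  next
    fix i j assume "i < d" "j < d"
    from twirl_shift[OF d c(2) this] trB
    show "(\<lambda>s. dpow ?X (dpow ?Z (B s - ?Z) d * ?X) d $$ (i,j)) \<in> O[Orderings.top](\<lambda>s. e s ^ 2)"
      by (cases "i = j") (auto simp del: index_mult_mat(1))
  qed
  obtain C1 where C1: "C1 > 0" "\<And>s. op_norm_mat (J_word d (A s) (B s) - 1\<^sub>m d) \<le> C1 * (cmod (e s))\<^sup>2"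
    using op_norm_bigo[OF J_word_bigo[OF d pow A B tZ tX] refl] by blast
  \<comment> \<open>Exchanging clock and shift merely swaps the two twirl hypotheses, so the same
    facts settle the other order of the word.\<close>
  obtain C2 where C2: "C2 > 0" "\<And>s. op_norm_mat (J_word d (B s) (A s) - 1\<^sub>m d) \<le> C2 * (cmod (e s))\<^sup>2"
    using op_norm_bigo[OF J_word_bigo[OF d pow(2,1) B A tX tZ] refl] by blast
  have bounds: "op_norm_mat (J_word d X' Z' - 1\<^sub>m d) \<le> C1 * \<epsilon>\<^sup>2"
    "op_norm_mat (J_word d Z' X' - 1\<^sub>m d) \<le> C2 * \<epsilon>\<^sup>2" if "good (\<epsilon>, X', Z')" for \<epsilon> X' Z'
    using C1(2)[of "(\<epsilon>, X', Z')"] C2(2)[of "(\<epsilon>, X', Z')"] that by (simp_all add: A_def B_def e_def)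
  show ?thesis
  proof (intro conjI)
    show "\<exists>\<epsilon>\<^sub>0>0. \<exists>C>0. \<forall>(\<epsilon>::real) X' Z'. 0 \<le> \<epsilon> \<longrightarrow> \<epsilon> < \<epsilon>\<^sub>0 \<longrightarrow>
        X' \<in> carrier_mat d d \<longrightarrow> Z' \<in> carrier_mat d d \<longrightarrow> unitary_mat X' \<longrightarrow> unitary_mat Z' \<longrightarrow>
        Determinant.det X' = Determinant.det ?X \<longrightarrow> Determinant.det Z' = Determinant.det ?Z \<longrightarrow>
        op_norm_mat (X' - ?X) \<le> \<epsilon> \<longrightarrow> op_norm_mat (Z' - ?Z) \<le> \<epsilon> \<longrightarrow>
        op_norm_mat (J_word d X' Z' - 1\<^sub>m d) \<le> C * \<epsilon>\<^sup>2"
      by (intro exI[of _ "1::real"] exI[of _ C1] conjI allI impI bounds(1))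
         (simp_all add: good_def C1(1))
    show "\<exists>\<epsilon>\<^sub>0>0. \<exists>C>0. \<forall>(\<epsilon>::real) X' Z'. 0 \<le> \<epsilon> \<longrightarrow> \<epsilon> < \<epsilon>\<^sub>0 \<longrightarrow>
        X' \<in> carrier_mat d d \<longrightarrow> Z' \<in> carrier_mat d d \<longrightarrow> unitary_mat X' \<longrightarrow> unitary_mat Z' \<longrightarrow>
        Determinant.det X' = Determinant.det ?X \<longrightarrow> Determinant.det Z' = Determinant.det ?Z \<longrightarrow>
        op_norm_mat (X' - ?X) \<le> \<epsilon> \<longrightarrow> op_norm_mat (Z' - ?Z) \<le> \<epsilon> \<longrightarrow>
        op_norm_mat (J_word d Z' X' - 1\<^sub>m d) \<le> C * \<epsilon>\<^sup>2"
      by (intro exI[of _ "1::real"] exI[of _ C2] conjI allI impI bounds(2))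
         (simp_all add: good_def C2(1))
  qed
qed

end
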